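(* Let $p$ be a prime, let $A\subseteq \mathbb{F}_p\smallsetminus\{0\}$ and let $0<\alpha<1$ satisfy $|A|\geq \alpha p$. Then, as $p\to\infty$ with $\alpha$ bounded below by a positive constant, $$|A(A+A)| > p-1-\alpha^{-3}(1-\alpha)^2+o(1).$$
   Context: For a prime $p$, $\mathbb{F}_p$ is the field with $p$ elements. For $A\subseteq\mathbb{F}_p$, $A(A+A)=\{a(b+c) : a,b,c\in A\}$, where $a,b,c$ need not be distinct. The density $\alpha$ is supposed bounded below by a positive constant while $p$ tends to infinity. The meaning of the $o(1)$ term is: for every $\alpha_0>0$ there is a real function $\varepsilon(p)$ (depending only on $\alpha_0$) with $\varepsilon(p)\to 0$ as $p\to\infty$, such that for all primes $p$, all $\alpha\in[\alpha_0,1)$ and all $A\subseteq\mathbb{F}_p\smallsetminus\{0\}$ with $|A|\ge\alpha p$, the inequality holds with $o(1)$ replaced by $\varepsilon(p)$. *)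

theory Defs
  imports Complex_Main "HOL-Number_Theory.Residues"
begin

abbreviation prime_field :: "nat \<Rightarrow> int ring" where
  "prime_field p \<equiv> residue_ring (int p)"

text \<open>The set $A(A+A)$; the elements \<open>a\<close>, \<open>b\<close>, \<open>c\<close> need not be distinct.\<close>

definition mult_sumset :: "('a, 'b) ring_scheme \<Rightarrow> 'a set \<Rightarrow> 'a set" where
  "mult_sumset R A = {a \<otimes>\<^bsub>R\<^esub> (b \<oplus>\<^bsub>R\<^esub> c) | a b c. a \<in> A \<and> b \<in> A \<and> c \<in> A}"

end

theory Submission
  imports Defs "HOL-Analysis.Convex"
begin

text \<open>
  The estimate holds for every prime with no error term, and even with \<open>(1 - \<alpha>)\<^sup>3\<close> in place of
  \<open>(1 - \<alpha>)\<^sup>2\<close>. Let \<open>n = |A|\<close> and let \<open>S\<close> be the set of nonzero residues missed by \<open>A(A+A)\<close>.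
  A nonzero residue \<open>d\<close> lies in \<open>S\<close> exactly when the equation \<open>b + c = d a\<^sup>-\<^sup>1\<close> has no solution in \<open>A\<close>.
  Written with additive characters \<open>e\<close>, that absence of solutions says that
  \<open>\<Sum>\<^sub>k F(k)\<^sup>2 G(-dk) = 0\<close>, where \<open>F(k) = \<Sum>\<^sub>a e(ka)\<close> and \<open>G(k) = \<Sum>\<^sub>a e(k a\<^sup>-\<^sup>1)\<close>. The term \<open>k = 0\<close> is
  \<open>n\<^sup>3\<close>, so summing over \<open>d\<close> gives
  \<open>|S| n\<^sup>3 \<le> \<Sum>\<^sub>k\<^sub>\<noteq>\<^sub>0 |F(k)|\<^sup>2 \<Sum>\<^bsub>d \<in> S\<^esub> |G(-dk)|\<close> (\<open>card_cube_le_char_sum\<close>).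

  For fixed \<open>k \<noteq> 0\<close> the products \<open>dk\<close> are distinct nonzero residues. Cauchy--Schwarz and Parseval
  therefore bound the inner sum by the square root of \<open>|S| n (p - n)\<close>, and Parseval again bounds the
  outer one: \<open>\<Sum>\<^sub>k\<^sub>\<noteq>\<^sub>0 |F(k)|\<^sup>2 = n (p - n)\<close>. Rearranged, this is
  \<open>|S| n\<^sup>3 \<le> (p - n)\<^sup>3\<close> (\<open>card_avoided_dilations\<close>). Dividing by \<open>p\<^sup>3\<close> and using
  \<open>n \<ge> \<alpha> p\<close> yields \<open>|S| \<le> ((1 - \<alpha>) / \<alpha>)\<^sup>3\<close>, which is smaller than \<open>\<alpha>\<^sup>-\<^sup>3 (1 - \<alpha>)\<^sup>2\<close> because \<open>0 < 1 - \<alpha> < 1\<close>.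
\<close>

section \<open>Additive characters modulo \<open>p\<close>\<close>

definition add_char :: "nat \<Rightarrow> int \<Rightarrow> complex" where
  "add_char p m = cis (2 * pi * of_int m / of_nat p)"

lemma add_char_0 [simp]: "add_char p 0 = 1"
  by (simp add: add_char_def)

lemma add_char_add: "add_char p (a + b) = add_char p a * add_char p b"
  by (simp add: add_char_def cis_mult add_divide_distrib ring_distribs)

lemma cnj_add_char: "cnj (add_char p a) = add_char p (- a)"
  by (simp add: add_char_def cis_cnj)

lemma add_char_power: "add_char p (int k * m) = add_char p m ^ k"
  by (simp add: add_char_def DeMoivre algebra_simps)

lemma add_char_eq_1_iff:
  assumes "p > 0"
  shows "add_char p m = 1 \<longleftrightarrow> int p dvd m"
proof
  assume "add_char p m = 1"
  then have "cos (2 * pi * of_int m / of_nat p) = 1"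
    by (simp add: add_char_def complex_eq_iff)
  then obtain n :: int where "2 * pi * of_int m / of_nat p = n * 2 * pi"
    by (auto simp: cos_one_2pi_int)
  then have "real_of_int m = real_of_int (n * int p)"
    using assms by (simp add: field_simps)
  then have "m = n * int p"
    by linarith
  then show "int p dvd m"
    by simp
next
  assume "int p dvd m"
  then obtain n where "m = int p * n" ..
  then have "2 * pi * of_int m / of_nat p = 2 * pi * of_int n"
    using assms by simp
  then show "add_char p m = 1"
    by (simp only: add_char_def cis_multiple_2pi Ints_of_int)
qed

lemma add_char_orthogonality:
  assumes "p > 0"
  shows "(\<Sum>k\<in>{0..<int p}. add_char p (k * m)) = (if int p dvd m then of_nat p else 0)"
proof -
  have "(\<Sum>k\<in>{0..<int p}. add_char p (k * m)) = (\<Sum>k<p. add_char p (int k * m))"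
    by (rule sum.reindex_bij_witness[where i = int and j = nat]) auto
  also have "\<dots> = (\<Sum>k<p. add_char p m ^ k)"
    by (simp add: add_char_power)
  also have "\<dots> = (if int p dvd m then of_nat p else 0)"
  proof (cases "int p dvd m")
    case True
    then have "add_char p m = 1"
      using assms by (simp add: add_char_eq_1_iff)
    with True show ?thesis
      by simp
  next
    case False
    have "add_char p m ^ p = 1"
      using add_char_power[of p p m] add_char_eq_1_iff[OF assms, of "int p * m"] by simp
    with False show ?thesis
      using assms by (simp add: add_char_eq_1_iff geometric_sum)
  qed
  finally show ?thesis .
qed

definition char_sum :: "nat \<Rightarrow> 'a set \<Rightarrow> ('a \<Rightarrow> int) \<Rightarrow> int \<Rightarrow> complex" where
  "char_sum p X \<phi> k = (\<Sum>x\<in>X. add_char p (k * \<phi> x))"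

lemma char_sum_0 [simp]: "char_sum p X \<phi> 0 = of_nat (card X)"
  by (simp add: char_sum_def)

text \<open>
  Allowing an arbitrary parametrization \<open>\<phi>\<close> that is injective modulo \<open>p\<close> makes this usable for
  every dilate of the set of inverses of \<open>A\<close>.
\<close>

lemma parseval_char_sum:
  assumes "p > 0" "finite X"
    and inj: "\<And>x y. x \<in> X \<Longrightarrow> y \<in> X \<Longrightarrow> int p dvd \<phi> x - \<phi> y \<Longrightarrow> x = y"
  shows "(\<Sum>k\<in>{0..<int p}. (cmod (char_sum p X \<phi> k))\<^sup>2) = real p * real (card X)"
proof -
  have char_diff: "add_char p (k * (\<phi> x - \<phi> y))
      = add_char p (k * \<phi> x) * cnj (add_char p (k * \<phi> y))" for k x y
    by (simp add: cnj_add_char right_diff_distrib flip: add_char_add)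
  have "complex_of_real (\<Sum>k\<in>{0..<int p}. (cmod (char_sum p X \<phi> k))\<^sup>2)
      = (\<Sum>k\<in>{0..<int p}. char_sum p X \<phi> k * cnj (char_sum p X \<phi> k))"
    by (simp only: of_real_sum complex_norm_square)
  also have "\<dots> = (\<Sum>k\<in>{0..<int p}. \<Sum>x\<in>X. \<Sum>y\<in>X. add_char p (k * (\<phi> x - \<phi> y)))"
    by (simp add: char_sum_def sum_product char_diff)
  also have "\<dots> = (\<Sum>x\<in>X. \<Sum>y\<in>X. \<Sum>k\<in>{0..<int p}. add_char p (k * (\<phi> x - \<phi> y)))"
    by (subst sum.swap, intro sum.cong refl sum.swap)
  also have "\<dots> = (\<Sum>x\<in>X. \<Sum>y\<in>X. if x = y then of_nat p else 0)"
  proof (intro sum.cong refl)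
    fix x y assume "x \<in> X" "y \<in> X"
    then have "int p dvd \<phi> x - \<phi> y \<longleftrightarrow> x = y"
      using inj by auto
    then show "(\<Sum>k\<in>{0..<int p}. add_char p (k * (\<phi> x - \<phi> y))) = (if x = y then of_nat p else 0)"
      using \<open>p > 0\<close> by (simp add: add_char_orthogonality)
  qed
  also have "\<dots> = complex_of_real (real p * real (card X))"
    using \<open>finite X\<close> by simp
  finally show ?thesis
    by (simp only: of_real_eq_iff)
qed

corollary parseval_char_sum_nonzero:
  assumes "p > 0" "finite X"
    and "\<And>x y. x \<in> X \<Longrightarrow> y \<in> X \<Longrightarrow> int p dvd \<phi> x - \<phi> y \<Longrightarrow> x = y"
  shows "(\<Sum>k\<in>{1..<int p}. (cmod (char_sum p X \<phi> k))\<^sup>2) = real (card X) * (real p - real (card X))"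
proof -
  have "{0..<int p} = insert 0 {1..<int p}"
    using \<open>p > 0\<close> by auto
  with parseval_char_sum[of p X \<phi>, OF assms] show ?thesis
    by (simp add: power2_eq_square algebra_simps)
qed

section \<open>Residues missed by \<open>A(A+A)\<close>\<close>

text \<open>
  By orthogonality, summing \<open>add_char p (k * (b + c + \<psi> a))\<close> over \<open>k\<close> and over all triples from \<open>A\<close>
  gives \<open>p\<close> times the number of solutions of \<open>b + c + \<psi> a = 0\<close> modulo \<open>p\<close>. With no solutions, the
  term \<open>k = 0\<close>, which is \<open>|A|\<^sup>3\<close>, must be cancelled by the others.
\<close>

lemma card_cube_le_char_sum:
  assumes "p > 0" "finite A"
    and no_sol: "\<And>a b c. a \<in> A \<Longrightarrow> b \<in> A \<Longrightarrow> c \<in> A \<Longrightarrow> \<not> int p dvd b + c + \<psi> a"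
  shows "real (card A) ^ 3
    \<le> (\<Sum>k\<in>{1..<int p}. (cmod (char_sum p A (\<lambda>a. a) k))\<^sup>2 * cmod (char_sum p A \<psi> k))"
proof -
  define f where "f k = char_sum p A (\<lambda>a. a) k * (char_sum p A (\<lambda>a. a) k * char_sum p A \<psi> k)" for k
  have "(\<Sum>k\<in>{0..<int p}. f k)
      = (\<Sum>k\<in>{0..<int p}. \<Sum>a\<in>A. \<Sum>c\<in>A. \<Sum>b\<in>A. add_char p (k * (b + c + \<psi> a)))"
    unfolding f_def char_sum_def sum_distrib_right sum_distrib_left
    by (simp only: add_char_add distrib_left mult.assoc)
  also have "\<dots> = (\<Sum>a\<in>A. \<Sum>c\<in>A. \<Sum>b\<in>A. \<Sum>k\<in>{0..<int p}. add_char p (k * (b + c + \<psi> a)))"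
    by (simp only: sum.swap[where A = "{0..<int p}" and B = A])
  also have "\<dots> = 0"
    using \<open>p > 0\<close> no_sol by (simp add: add_char_orthogonality)
  finally have total: "(\<Sum>k\<in>{0..<int p}. f k) = 0" .
  have "{0..<int p} = insert 0 {1..<int p}"
    using \<open>p > 0\<close> by auto
  with total have "f 0 + (\<Sum>k\<in>{1..<int p}. f k) = 0"
    by simp
  then have "cmod (f 0) = cmod (\<Sum>k\<in>{1..<int p}. f k)"
    by (metis add_eq_0_iff norm_minus_cancel)
  also have "\<dots> \<le> (\<Sum>k\<in>{1..<int p}. cmod (f k))"
    by (rule norm_sum)
  finally show ?thesis
    by (simp add: f_def norm_mult power2_eq_square power3_eq_cube mult.assoc)
qed

lemma eq_if_dvd_diff_residues:
  fixes x y :: int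
  assumes "x \<in> {1..<m}" "y \<in> {1..<m}" "m dvd x - y"
  shows "x = y"
proof -
  have "x mod m = y mod m"
    using assms(3) by (simp add: mod_eq_dvd_iff)
  then show ?thesis
    using assms(1,2) by simp
qed

text \<open>
  The hypotheses describe a set \<open>S\<close> of nonzero residues \<open>d\<close> for which \<open>d \<iota>(a)\<close> never lies in
  \<open>A + A\<close>; in the application \<open>\<iota> a\<close> is an inverse of \<open>a\<close>.
  Summing over \<open>d \<in> S\<close> is what wins: the character sum over a single dilate can have order \<open>p\<close>, but
  its squared modulus adds up to only \<open>n (p - n)\<close> over all dilations \<open>d\<close>, where \<open>n = |A|\<close>.
\<close>

lemma card_avoided_dilations:
  assumes "prime p" and A: "A \<subseteq> {1..<int p}" and S: "S \<subseteq> {1..<int p}"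
    and inj: "\<And>a b. a \<in> A \<Longrightarrow> b \<in> A \<Longrightarrow> int p dvd \<iota> a - \<iota> b \<Longrightarrow> a = b"
    and no_sol: "\<And>d a b c. d \<in> S \<Longrightarrow> a \<in> A \<Longrightarrow> b \<in> A \<Longrightarrow> c \<in> A \<Longrightarrow> \<not> int p dvd b + c - d * \<iota> a"
  shows "real (card S) * real (card A) ^ 3 \<le> (real p - real (card A)) ^ 3"
proof -
  define n where "n = real (card A)"
  define s where "s = real (card S)"
  define E where "E = n * (real p - n)"
  define F where "F k = (cmod (char_sum p A (\<lambda>a. a) k))\<^sup>2" for k
  define G where "G d k = cmod (char_sum p A (\<lambda>a. - (d * \<iota> a)) k)" for d k
  have p: "p > 0"
    using \<open>prime p\<close> prime_gt_0_nat by blast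
  have fin: "finite A" "finite S"
    using A S finite_subset by blast+
  have "card A \<le> card {1..<int p}"
    using A by (intro card_mono) auto
  then have n_le: "n \<le> real p - 1"
    using p by (simp add: n_def)
  have n0: "0 \<le> n" and s0: "0 \<le> s"
    by (simp_all add: n_def s_def)
  have E0: "0 \<le> E"
    using n_le n0 by (simp add: E_def)

  have sum_F: "(\<Sum>k\<in>{1..<int p}. F k) = E"
    unfolding F_def E_def n_def
  proof (rule parseval_char_sum_nonzero[OF p fin(1)])
    fix x y assume "x \<in> A" "y \<in> A" "int p dvd x - y"
    then show "x = y"
      using A eq_if_dvd_diff_residues by blast
  qed

  have sum_G: "(\<Sum>d\<in>S. G d k) \<le> sqrt (s * E)" if k: "k \<in> {1..<int p}" for k
  proof -
    have cop: "coprime (int p) k"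
      using \<open>prime p\<close> k by (intro prime_imp_coprime) (auto dest: zdvd_imp_le)
    have "(\<Sum>d\<in>S. G d k)\<^sup>2 = (\<Sum>d\<in>S. 1 * G d k)\<^sup>2"
      by simp
    also have "\<dots> \<le> (\<Sum>d\<in>S. 1\<^sup>2) * (\<Sum>d\<in>S. (G d k)\<^sup>2)"
      by (rule Cauchy_Schwarz_ineq_sum)
    also have "\<dots> \<le> s * (\<Sum>d\<in>{1..<int p}. (G d k)\<^sup>2)"
      using S by (auto simp: s_def intro!: mult_left_mono sum_mono2)
    \<comment> \<open>The roles of the frequency \<open>k\<close> and the dilation \<open>d\<close> are interchangeable.\<close>
    also have "(\<Sum>d\<in>{1..<int p}. (G d k)\<^sup>2)
        = (\<Sum>d\<in>{1..<int p}. (cmod (char_sum p A (\<lambda>a. - (k * \<iota> a)) d))\<^sup>2)"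
      by (simp add: G_def char_sum_def mult_ac)
    also have "\<dots> = E"
      unfolding E_def n_def
    proof (rule parseval_char_sum_nonzero[OF p fin(1)])
      fix x y assume xy: "x \<in> A" "y \<in> A" "int p dvd - (k * \<iota> x) - - (k * \<iota> y)"
      then have "int p dvd k * (\<iota> y - \<iota> x)"
        by (simp add: algebra_simps)
      then have "int p dvd \<iota> y - \<iota> x"
        using cop by (simp add: coprime_dvd_mult_right_iff)
      then show "x = y"
        using inj xy by blast
    qed
    finally show ?thesis
      by (rule real_le_rsqrt)
  qed

  have "s * n ^ 3 = (\<Sum>d\<in>S. n ^ 3)"
    by (simp add: s_def)
  also have "\<dots> \<le> (\<Sum>d\<in>S. \<Sum>k\<in>{1..<int p}. F k * G d k)"
    unfolding F_def G_def n_def using no_sol by (intro sum_mono card_cube_le_char_sum p fin) auto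
  also have "\<dots> = (\<Sum>k\<in>{1..<int p}. F k * (\<Sum>d\<in>S. G d k))"
    by (subst sum.swap) (simp add: sum_distrib_left)
  also have "\<dots> \<le> (\<Sum>k\<in>{1..<int p}. F k * sqrt (s * E))"
    by (intro sum_mono mult_left_mono sum_G) (auto simp: F_def)
  also have "\<dots> = E * sqrt (s * E)"
    by (simp add: sum_F flip: sum_distrib_right)
  finally have "(s * n ^ 3)\<^sup>2 \<le> (E * sqrt (s * E))\<^sup>2"
    using s0 n0 by (intro power_mono) auto
  also have "\<dots> = E\<^sup>2 * (s * E)"
    using s0 E0 by (simp add: power_mult_distrib)
  finally have le: "(s * n ^ 3) * (s * n ^ 3) \<le> (s * n ^ 3) * (real p - n) ^ 3"
    by (simp add: E_def power2_eq_square power3_eq_cube mult_ac)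
  show ?thesis
  proof (cases "s * n ^ 3 = 0")
    case True
    moreover have "0 \<le> (real p - n) ^ 3"
      using n_le by simp
    ultimately show ?thesis
      by (simp only: n_def s_def)
  next
    case False
    then have "0 < s * n ^ 3"
      using s0 n0 by (simp add: less_le)
    with le have "s * n ^ 3 \<le> (real p - n) ^ 3"
      by (simp only: mult_le_cancel_left_pos)
    then show ?thesis
      by (simp only: n_def s_def)
  qed
qed

text \<open>
  Zero may or may not lie in \<open>A(A+A)\<close>, which is why only the \<open>p - 1\<close> nonzero residues are counted.
\<close>

lemma card_mult_sumset_prime_field:
  assumes "prime p" and A: "A \<subseteq> {1..<int p}"
  shows "(real p - 1 - real (card (mult_sumset (prime_field p) A))) * real (card A) ^ 3
    \<le> (real p - real (card A)) ^ 3"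
proof -
  interpret residues_prime p "prime_field p"
    by unfold_locales (use \<open>prime p\<close> in simp_all)
  define M where "M = mult_sumset (prime_field p) A"
  define S where "S = {1..<int p} - M"
  have M: "M = {(a * ((b + c) mod int p)) mod int p | a b c. a \<in> A \<and> b \<in> A \<and> c \<in> A}"
    by (simp add: M_def mult_sumset_def res_mult_eq res_add_eq)
  have "M \<subseteq> {0..<int p}"
    using \<open>prime p\<close> prime_gt_0_nat by (auto simp: M)
  then have "finite M"
    using finite_subset by blast
  have "\<exists>x. [a * x = 1] (mod int p)" if "a \<in> A" for a
  proof (rule cong_solve_coprime_int)
    have "a \<in> {1..<int p}"
      using A that by blast
    then have "coprime (int p) a"
      using \<open>prime p\<close> by (intro prime_imp_coprime) (auto dest: zdvd_imp_le)
    then show "coprime a (int p)"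
      by (simp add: coprime_commute)
  qed
  then obtain \<iota> where \<iota>: "\<And>a. a \<in> A \<Longrightarrow> [a * \<iota> a = 1] (mod int p)"
    by metis

  have "real (card S) * real (card A) ^ 3 \<le> (real p - real (card A)) ^ 3"
  proof (rule card_avoided_dilations[OF \<open>prime p\<close> A])
    show "S \<subseteq> {1..<int p}"
      by (auto simp: S_def)
  next
    fix a b assume ab: "a \<in> A" "b \<in> A" "int p dvd \<iota> a - \<iota> b"
    then have "[\<iota> a = \<iota> b] (mod int p)"
      by (simp add: cong_iff_dvd_diff)
    have "[a = a * (b * \<iota> b)] (mod int p)"
      using cong_scalar_left[OF \<iota>[OF ab(2)], of a] by (simp add: cong_sym)
    also have "[a * (b * \<iota> b) = a * (b * \<iota> a)] (mod int p)"
      by (intro cong_scalar_left cong_sym[OF \<open>[\<iota> a = \<iota> b] (mod int p)\<close>])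
    also have "a * (b * \<iota> a) = b * (a * \<iota> a)"
      by simp
    also have "[b * (a * \<iota> a) = b] (mod int p)"
      using cong_scalar_left[OF \<iota>[OF ab(1)], of b] by simp
    finally have "int p dvd a - b"
      by (simp add: cong_iff_dvd_diff)
    then show "a = b"
      using A ab(1,2) eq_if_dvd_diff_residues by blast
  next
    fix d a b c assume d: "d \<in> S" and abc: "a \<in> A" "b \<in> A" "c \<in> A"
    show "\<not> int p dvd b + c - d * \<iota> a"
    proof
      assume "int p dvd b + c - d * \<iota> a"
      then have "[b + c = d * \<iota> a] (mod int p)"
        by (simp add: cong_iff_dvd_diff)
      then have "[a * (b + c) = a * (d * \<iota> a)] (mod int p)"
        by (rule cong_scalar_left)
      also have "a * (d * \<iota> a) = d * (a * \<iota> a)"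
        by simp
      also have "[d * (a * \<iota> a) = d] (mod int p)"
        using cong_scalar_left[OF \<iota>[OF abc(1)], of d] by simp
      finally have "(a * ((b + c) mod int p)) mod int p = d"
        using d by (simp add: cong_def S_def mod_mult_right_eq)
      then have "d \<in> M"
        using abc unfolding M by blast
      with d show False
        by (simp add: S_def)
    qed
  qed
  moreover have "card {1..<int p} - card M \<le> card S"
    unfolding S_def by (rule diff_card_le_card_Diff[OF \<open>finite M\<close>])
  then have "real p - 1 - real (card M) \<le> real (card S)"
    by simp
  then have "(real p - 1 - real (card M)) * real (card A) ^ 3 \<le> real (card S) * real (card A) ^ 3"
    by (rule mult_right_mono) simp
  ultimately show ?thesis
    by (simp add: M_def)
qed

section \<open>The bound in terms of the density\<close>

theorem theorem1p2:
  fixes \<alpha>\<^sub>0 :: real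
  assumes "\<alpha>\<^sub>0 > 0"
  shows "\<exists>\<epsilon> :: nat \<Rightarrow> real. \<epsilon> \<longlonglongrightarrow> 0 \<and>
    (\<forall>(p :: nat) (\<alpha> :: real) (A :: int set).
       prime p \<longrightarrow> \<alpha>\<^sub>0 \<le> \<alpha> \<longrightarrow> \<alpha> < 1 \<longrightarrow>
       A \<subseteq> carrier (prime_field p) - {\<zero>\<^bsub>prime_field p\<^esub>} \<longrightarrow>
       real (card A) \<ge> \<alpha> * real p \<longrightarrow>
       real (card (mult_sumset (prime_field p) A))
         > real p - 1 - inverse (\<alpha> ^ 3) * (1 - \<alpha>)\<^sup>2 + \<epsilon> p)"
proof (intro exI[of _ "\<lambda>_. 0"] conjI allI impI)
  fix p :: nat and \<alpha> :: real and A :: "int set"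
  assume "prime p" and "\<alpha>\<^sub>0 \<le> \<alpha>" and "\<alpha> < 1"
    and A: "A \<subseteq> carrier (prime_field p) - {\<zero>\<^bsub>prime_field p\<^esub>}"
    and dens: "real (card A) \<ge> \<alpha> * real p"
  interpret residues_prime p "prime_field p"
    by unfold_locales (use \<open>prime p\<close> in simp_all)
  have "\<alpha> > 0"
    using assms \<open>\<alpha>\<^sub>0 \<le> \<alpha>\<close> by simp
  have p: "real p > 0"
    using \<open>prime p\<close> prime_gt_0_nat by simp
  have A': "A \<subseteq> {1..<int p}"
  proof
    fix x assume "x \<in> A"
    then have "0 \<le> x" "x \<le> int p - 1" "x \<noteq> 0"
      using A by (auto simp: res_carrier_eq res_zero_eq)
    then show "x \<in> {1..<int p}"
      by simp
  qed
  define t where "t = real p - 1 - real (card (mult_sumset (prime_field p) A))"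
  have "card A \<le> card {1..<int p}"
    using A' by (intro card_mono) auto
  then have card_le: "real (card A) \<le> real p"
    by simp
  have "t < (1 - \<alpha>)\<^sup>2 / \<alpha> ^ 3"
  proof (cases "t \<le> 0")
    case True
    then show ?thesis
      using \<open>\<alpha> > 0\<close> \<open>\<alpha> < 1\<close> by (smt (verit) divide_pos_pos zero_less_power)
  next
    case False
    have "(t * \<alpha> ^ 3) * real p ^ 3 = t * (\<alpha> * real p) ^ 3"
      by (simp add: power_mult_distrib)
    also have "\<dots> \<le> t * real (card A) ^ 3"
      using False dens \<open>\<alpha> > 0\<close> by (intro mult_left_mono power_mono) auto
    also have "\<dots> \<le> (real p - real (card A)) ^ 3"
      using card_mult_sumset_prime_field[OF \<open>prime p\<close> A'] by (simp add: t_def)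
    also have "\<dots> \<le> ((1 - \<alpha>) * real p) ^ 3"
      using card_le dens by (intro power_mono) (auto simp: algebra_simps)
    finally have "t * \<alpha> ^ 3 \<le> (1 - \<alpha>) ^ 3"
      using p by (simp add: power_mult_distrib)
    also have "\<dots> < (1 - \<alpha>)\<^sup>2"
      using \<open>\<alpha> > 0\<close> \<open>\<alpha> < 1\<close> by (intro power_strict_decreasing) auto
    finally show ?thesis
      using \<open>\<alpha> > 0\<close> by (simp add: pos_less_divide_eq)
  qed
  then show "real (card (mult_sumset (prime_field p) A))
      > real p - 1 - inverse (\<alpha> ^ 3) * (1 - \<alpha>)\<^sup>2 + 0"
    by (simp add: t_def field_simps)
qed simp

end
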